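(* Let $K$ be a field, $\lambda\in K$, let $(A,\mu,\alpha,\beta)$ be a BiHom-commutative BiHom-associative algebra, let $\xi,\zeta,\iota:A\to A$ be three algebra maps and let $\mathfrak D:A\to A$ be a $\lambda$-$(\xi,\xi)$-derivation, such that any two of the maps $\alpha,\beta,\xi,\zeta,\iota,\mathfrak D$ commute. Define a new multiplication on $A$ by $$a\ast b=\zeta(a)\,\iota\mathfrak D(b),\qquad a,b\in A.$$ Then $(A,\ast,\zeta\alpha,\iota\beta\xi)$ is a BiHom-pre-Lie algebra and a BiHom-Novikov algebra.
   Context: BiHom-associative algebra $(A,\mu,\alpha,\beta)$: a $K$-vector space with linear $\mu:A\otimes A\to A$ (written $ab$), $\alpha,\beta:A\to A$ such that $\alpha\beta=\beta\alpha$, $\alpha(ab)=\alpha(a)\alpha(b)$, $\beta(ab)=\beta(a)\beta(b)$, $\alpha(a)(bc)=(ab)\beta(c)$. BiHom-commutative: $\beta(a)\alpha(b)=\beta(b)\alpha(a)$ for all $a,b$. An algebra map is a linear map $f$ with $f(ab)=f(a)f(b)$ (no unit is assumed). $\lambda$-$(\xi,\zeta)$-derivation: a linear $\mathfrak D:A\to A$ with $\mathfrak D(ab)=\xi(a)\mathfrak D(b)+\mathfrak D(a)\zeta(b)+\lambda\xi(a)\zeta(b)$. (Left) BiHom-pre-Lie algebra $(A,\circ,\alpha,\beta)$: bilinear $\circ$, commuting linear $\alpha,\beta$ multiplicative for $\circ$, with $\alpha\beta(a)\circ(\alpha(b)\circ c)-(\beta(a)\circ\alpha(b))\circ\beta(c)=\alpha\beta(b)\circ(\alpha(a)\circ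 c)-(\beta(b)\circ\alpha(a))\circ\beta(c)$. It is a BiHom-Novikov algebra if moreover $(a\circ\beta(b))\circ\alpha\beta(c)=(a\circ\beta(c))\circ\alpha\beta(b)$ for all $a,b,c$. *)

theory Defs
  imports Complex_Main
begin

text \<open>A linear map on the tensor square of the underlying space is given by its bilinear
  counterpart \<open>m :: 'a \<Rightarrow> 'a \<Rightarrow> 'a\<close>.\<close>

locale bilinear_mult = vector_space scale
  for scale :: "'k::field \<Rightarrow> 'a::ab_group_add \<Rightarrow> 'a" +
  fixes m :: "'a \<Rightarrow> 'a \<Rightarrow> 'a"
  assumes linear_left: "Vector_Spaces.linear scale scale (\<lambda>a. m a b)"
    and linear_right: "Vector_Spaces.linear scale scale (\<lambda>b. m a b)"

definition algebra_map ::
    "('k::field \<Rightarrow> 'a::ab_group_add \<Rightarrow> 'a) \<Rightarrow> ('a \<Rightarrow> 'a \<Rightarrow> 'a) \<Rightarrow> ('a \<Rightarrow> 'a) \<Rightarrow> bool"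
  where "algebra_map scale m f \<longleftrightarrow>
    Vector_Spaces.linear scale scale f \<and> (\<forall>a b. f (m a b) = m (f a) (f b))"

locale bihom_algebra = bilinear_mult scale m
  for scale :: "'k::field \<Rightarrow> 'a::ab_group_add \<Rightarrow> 'a" and m :: "'a \<Rightarrow> 'a \<Rightarrow> 'a" +
  fixes \<alpha> \<beta> :: "'a \<Rightarrow> 'a"
  assumes structure_maps_commute: "\<alpha> \<circ> \<beta> = \<beta> \<circ> \<alpha>"
    and algebra_map_alpha: "algebra_map scale m \<alpha>"
    and algebra_map_beta: "algebra_map scale m \<beta>"

locale bihom_associative_algebra = bihom_algebra scale m \<alpha> \<beta>
  for scale :: "'k::field \<Rightarrow> 'a::ab_group_add \<Rightarrow> 'a" and m :: "'a \<Rightarrow> 'a \<Rightarrow> 'a"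
    and \<alpha> \<beta> :: "'a \<Rightarrow> 'a" +
  assumes bihom_assoc: "m (\<alpha> a) (m b c) = m (m a b) (\<beta> c)"

locale bihom_commutative_associative_algebra = bihom_associative_algebra scale m \<alpha> \<beta>
  for scale :: "'k::field \<Rightarrow> 'a::ab_group_add \<Rightarrow> 'a" and m :: "'a \<Rightarrow> 'a \<Rightarrow> 'a"
    and \<alpha> \<beta> :: "'a \<Rightarrow> 'a" +
  assumes bihom_comm: "m (\<beta> a) (\<alpha> b) = m (\<beta> b) (\<alpha> a)"

definition weighted_derivation ::
    "('k::field \<Rightarrow> 'a::ab_group_add \<Rightarrow> 'a) \<Rightarrow> ('a \<Rightarrow> 'a \<Rightarrow> 'a) \<Rightarrow> 'k
      \<Rightarrow> ('a \<Rightarrow> 'a) \<Rightarrow> ('a \<Rightarrow> 'a) \<Rightarrow> ('a \<Rightarrow> 'a) \<Rightarrow> bool"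
  where "weighted_derivation scale m l \<xi> \<zeta> D \<longleftrightarrow>
    Vector_Spaces.linear scale scale D \<and>
    (\<forall>a b. D (m a b) = m (\<xi> a) (D b) + m (D a) (\<zeta> b) + scale l (m (\<xi> a) (\<zeta> b)))"

locale bihom_pre_lie_algebra = bihom_algebra scale m \<alpha> \<beta>
  for scale :: "'k::field \<Rightarrow> 'a::ab_group_add \<Rightarrow> 'a" and m :: "'a \<Rightarrow> 'a \<Rightarrow> 'a"
    and \<alpha> \<beta> :: "'a \<Rightarrow> 'a" +
  assumes bihom_pre_lie:
    "m (\<alpha> (\<beta> a)) (m (\<alpha> b) c) - m (m (\<beta> a) (\<alpha> b)) (\<beta> c)
     = m (\<alpha> (\<beta> b)) (m (\<alpha> a) c) - m (m (\<beta> b) (\<alpha> a)) (\<beta> c)"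

locale bihom_novikov_algebra = bihom_pre_lie_algebra scale m \<alpha> \<beta>
  for scale :: "'k::field \<Rightarrow> 'a::ab_group_add \<Rightarrow> 'a" and m :: "'a \<Rightarrow> 'a \<Rightarrow> 'a"
    and \<alpha> \<beta> :: "'a \<Rightarrow> 'a" +
  assumes bihom_novikov: "m (m a (\<beta> b)) (\<alpha> (\<beta> c)) = m (m a (\<beta> c)) (\<alpha> (\<beta> b))"

end

theory Submission
  imports Defs
begin

text \<open>Write \<open>u = \<zeta>\<^sup>2\<iota>(a)\<close> and \<open>v = \<zeta>\<^sup>2\<iota>(b)\<close>. Expanding \<open>D\<close> of the inner product in the first term
  of the pre-Lie identity gives three summands. The summand containing \<open>D(v)\<close> is cancelled by the
  second term of the identity, by BiHom-associativity; the other two have the form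
  \<open>\<alpha>\<beta>\<xi>(u)(\<alpha>\<xi>(v)w)\<close>, which is symmetric in \<open>u\<close> and \<open>v\<close> by BiHom-associativity and
  BiHom-commutativity. The Novikov identity is likewise an instance of the symmetry of
  \<open>(x\<beta>(p))\<alpha>\<beta>(q)\<close> in \<open>p\<close> and \<open>q\<close>.\<close>

context bihom_commutative_associative_algebra
begin

text \<open>BiHom-associativity with \<open>\<beta> u\<close> as first factor rebrackets the left
  side to \<open>m (m (\<beta> u) (\<alpha> v)) (\<beta> w)\<close>, where BiHom-commutativity swaps
  \<open>u\<close> and \<open>v\<close>.\<close>

lemma left_commute: "m (\<alpha> (\<beta> u)) (m (\<alpha> v) w) = m (\<alpha> (\<beta> v)) (m (\<alpha> u) w)"
  by (metis bihom_assoc bihom_comm)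

text \<open>Since \<alpha> and \<beta> commute, the last factor is
  \<open>\<beta> (\<alpha> q)\<close>, so BiHom-associativity isolates the product
  \<open>m (\<beta> p) (\<alpha> q)\<close>, which is symmetric in \<open>p\<close> and
  \<open>q\<close>.\<close>

lemma right_commute: "m (m x (\<beta> p)) (\<alpha> (\<beta> q)) = m (m x (\<beta> q)) (\<alpha> (\<beta> p))"
  by (metis bihom_assoc bihom_comm comp_apply structure_maps_commute)

end

theorem theorem3p5:
  fixes scale :: "'k::field \<Rightarrow> 'a::ab_group_add \<Rightarrow> 'a"
    and \<mu> :: "'a \<Rightarrow> 'a \<Rightarrow> 'a"
    and \<alpha> \<beta> \<xi> \<zeta> \<iota> D :: "'a \<Rightarrow> 'a"
    and l :: 'k
  assumes "bihom_commutative_associative_algebra scale \<mu> \<alpha> \<beta>"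
    and "algebra_map scale \<mu> \<xi>"
    and "algebra_map scale \<mu> \<zeta>"
    and "algebra_map scale \<mu> \<iota>"
    and "weighted_derivation scale \<mu> l \<xi> \<xi> D"
    and "\<forall>f\<in>{\<alpha>, \<beta>, \<xi>, \<zeta>, \<iota>, D}. \<forall>g\<in>{\<alpha>, \<beta>, \<xi>, \<zeta>, \<iota>, D}. f \<circ> g = g \<circ> f"
  shows "bihom_pre_lie_algebra scale (\<lambda>a b. \<mu> (\<zeta> a) (\<iota> (D b))) (\<zeta> \<circ> \<alpha>) (\<iota> \<circ> \<beta> \<circ> \<xi>)
       \<and> bihom_novikov_algebra scale (\<lambda>a b. \<mu> (\<zeta> a) (\<iota> (D b))) (\<zeta> \<circ> \<alpha>) (\<iota> \<circ> \<beta> \<circ> \<xi>)"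
proof -
  let ?m = "\<lambda>a b. \<mu> (\<zeta> a) (\<iota> (D b))"
  interpret bihom_commutative_associative_algebra scale \<mu> \<alpha> \<beta> by fact
  have linear: "Vector_Spaces.linear scale scale f" if "f \<in> {\<alpha>, \<beta>, \<xi>, \<zeta>, \<iota>, D}" for f
    using that assms(2-5) algebra_map_alpha algebra_map_beta
    by (auto simp: algebra_map_def weighted_derivation_def)
  have mult: "f (\<mu> a b) = \<mu> (f a) (f b)" if "f \<in> {\<alpha>, \<beta>, \<xi>, \<zeta>, \<iota>}" for f a b
    using that assms(2-4) algebra_map_alpha algebra_map_beta
    by (auto simp: algebra_map_def)
  have leibniz: "D (\<mu> a b) = \<mu> (\<xi> a) (D b) + \<mu> (D a) (\<xi> b) + scale l (\<mu> (\<xi> a) (\<xi> b))" for a b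
    using assms(5) by (simp add: weighted_derivation_def)
  have comm: "f (g x) = g (f x)"
    if "f \<in> {\<alpha>, \<beta>, \<xi>, \<zeta>, \<iota>, D}" "g \<in> {\<alpha>, \<beta>, \<xi>, \<zeta>, \<iota>, D}" for f g x
    using assms(6) that by (metis comp_apply)
  \<comment> \<open>Oriented as rewrite rules, these sort every composite into the order \<alpha>,
    \<beta>, \<xi>, \<zeta>, \<iota>, \<open>D\<close> from the outside in. Equal composites become
    identical, and \<alpha>, \<beta> surface where BiHom-associativity can match them.\<close>
  note maps_commute =
    comm[of \<beta> \<alpha>, simplified]
    comm[of \<xi> \<alpha>, simplified] comm[of \<xi> \<beta>, simplified]
    comm[of \<zeta> \<alpha>, simplified] comm[of \<zeta> \<beta>, simplified] comm[of \<zeta> \<xi>, simplified]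
    comm[of \<iota> \<alpha>, simplified] comm[of \<iota> \<beta>, simplified] comm[of \<iota> \<xi>, simplified]
    comm[of \<iota> \<zeta>, simplified]
    comm[of D \<alpha>, simplified] comm[of D \<beta>, simplified] comm[of D \<xi>, simplified]
    comm[of D \<zeta>, simplified] comm[of D \<iota>, simplified]
  note maps_mult = mult[of \<alpha>, simplified] mult[of \<beta>, simplified] mult[of \<xi>, simplified]
    mult[of \<zeta>, simplified] mult[of \<iota>, simplified]
  note linear_comp = Vector_Spaces.linear_compose
  have iota_D: "Vector_Spaces.linear scale scale (\<lambda>b. \<iota> (D b))"
    using linear_comp[OF linear[of D] linear[of \<iota>]] by (simp add: comp_def)
  have bilinear: "bilinear_mult scale ?m"
  proof (intro bilinear_mult.intro bilinear_mult_axioms.intro vector_space_axioms)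
    show "Vector_Spaces.linear scale scale (\<lambda>a. ?m a b)" for b
      using linear_comp[OF linear[of \<zeta>] linear_left[of "\<iota> (D b)"]] by (simp add: comp_def)
    show "Vector_Spaces.linear scale scale (\<lambda>b. ?m a b)" for a
      using linear_comp[OF iota_D linear_right[of "\<zeta> a"]] by (simp add: comp_def)
  qed
  have bihom: "bihom_algebra scale ?m (\<zeta> \<circ> \<alpha>) (\<iota> \<circ> \<beta> \<circ> \<xi>)"
  proof (intro bihom_algebra.intro bihom_algebra_axioms.intro bilinear)
    show "\<zeta> \<circ> \<alpha> \<circ> (\<iota> \<circ> \<beta> \<circ> \<xi>) = \<iota> \<circ> \<beta> \<circ> \<xi> \<circ> (\<zeta> \<circ> \<alpha>)"
      by (simp add: fun_eq_iff maps_commute)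
    \<comment> \<open>A composite of algebra maps of \<open>\<mu>\<close> that commutes with
      \<zeta>, \<iota> and \<open>D\<close> is multiplicative for \<open>?m\<close> as well.\<close>
    show "algebra_map scale ?m (\<zeta> \<circ> \<alpha>)"
      using linear_comp[OF linear[of \<alpha>] linear[of \<zeta>]]
      by (simp add: algebra_map_def maps_mult maps_commute)
    show "algebra_map scale ?m (\<iota> \<circ> \<beta> \<circ> \<xi>)"
      using linear_comp[OF linear[of \<xi>] linear_comp[OF linear[of \<beta>] linear[of \<iota>]]]
      by (simp add: algebra_map_def maps_mult maps_commute)
  qed
  have iota_add: "\<iota> (x + y) = \<iota> x + \<iota> y" and iota_scale: "\<iota> (scale r x) = scale r (\<iota> x)" for x y r
    using linear[of \<iota>] by (simp_all add: Vector_Spaces.linear_iff)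
  have \<mu>_add: "\<mu> a (x + y) = \<mu> a x + \<mu> a y" and \<mu>_scale: "\<mu> a (scale r x) = scale r (\<mu> a x)"
    for a x y r
    using linear_right[of a] by (simp_all add: Vector_Spaces.linear_iff)
  \<comment> \<open>On the right, \<open>a\<close> and \<open>b\<close> enter only through
    \<xi>\<zeta>\<zeta>\<iota>, so swapping them is an instance of \<open>left_commute\<close> in
    each summand.\<close>
  have reduced: "?m ((\<zeta> \<circ> \<alpha>) ((\<iota> \<circ> \<beta> \<circ> \<xi>) a)) (?m ((\<zeta> \<circ> \<alpha>) b) c)
        - ?m (?m ((\<iota> \<circ> \<beta> \<circ> \<xi>) a) ((\<zeta> \<circ> \<alpha>) b)) ((\<iota> \<circ> \<beta> \<circ> \<xi>) c)
      = \<mu> (\<alpha> (\<beta> (\<xi> (\<zeta> (\<zeta> (\<iota> a)))))) (\<mu> (\<alpha> (\<xi> (\<zeta> (\<zeta> (\<iota> b))))) (\<iota> (\<iota> (D (D c)))))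
        + scale l (\<mu> (\<alpha> (\<beta> (\<xi> (\<zeta> (\<zeta> (\<iota> a)))))) (\<mu> (\<alpha> (\<xi> (\<zeta> (\<zeta> (\<iota> b))))) (\<xi> (\<iota> (\<iota> (D c))))))"
    for a b c
    \<comment> \<open>The flipped BiHom-associativity turns the subtracted term, whose last factor
      is \<beta> applied to \<xi>\<iota>\<iota>\<open>D\<close>(c), into exactly the Leibniz summand
      containing \<open>D b\<close>.\<close>
    by (simp add: maps_mult maps_commute leibniz iota_add iota_scale \<mu>_add \<mu>_scale
        flip: bihom_assoc)
  have pre_lie: "bihom_pre_lie_algebra scale ?m (\<zeta> \<circ> \<alpha>) (\<iota> \<circ> \<beta> \<circ> \<xi>)"
    using bihom
  proof (rule bihom_pre_lie_algebra.intro, intro bihom_pre_lie_algebra_axioms.intro)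
    fix a b c
    show "?m ((\<zeta> \<circ> \<alpha>) ((\<iota> \<circ> \<beta> \<circ> \<xi>) a)) (?m ((\<zeta> \<circ> \<alpha>) b) c)
        - ?m (?m ((\<iota> \<circ> \<beta> \<circ> \<xi>) a) ((\<zeta> \<circ> \<alpha>) b)) ((\<iota> \<circ> \<beta> \<circ> \<xi>) c)
      = ?m ((\<zeta> \<circ> \<alpha>) ((\<iota> \<circ> \<beta> \<circ> \<xi>) b)) (?m ((\<zeta> \<circ> \<alpha>) a) c)
        - ?m (?m ((\<iota> \<circ> \<beta> \<circ> \<xi>) b) ((\<zeta> \<circ> \<alpha>) a)) ((\<iota> \<circ> \<beta> \<circ> \<xi>) c)"
      unfolding reduced
      using left_commute[of "\<xi> (\<zeta> (\<zeta> (\<iota> a)))" "\<xi> (\<zeta> (\<zeta> (\<iota> b)))"] by simp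
  qed
  moreover have "bihom_novikov_algebra scale ?m (\<zeta> \<circ> \<alpha>) (\<iota> \<circ> \<beta> \<circ> \<xi>)"
    using pre_lie
  proof (rule bihom_novikov_algebra.intro, intro bihom_novikov_algebra_axioms.intro)
    fix a b c
    show "?m (?m a ((\<iota> \<circ> \<beta> \<circ> \<xi>) b)) ((\<zeta> \<circ> \<alpha>) ((\<iota> \<circ> \<beta> \<circ> \<xi>) c))
      = ?m (?m a ((\<iota> \<circ> \<beta> \<circ> \<xi>) c)) ((\<zeta> \<circ> \<alpha>) ((\<iota> \<circ> \<beta> \<circ> \<xi>) b))"
      \<comment> \<open>The arguments are read off the sorted form of the left side:
        (\<zeta>\<zeta>(a) \<beta>(p)) \<alpha>\<beta>(q) with p =
        \<xi>\<zeta>\<iota>\<iota>\<open>D\<close>(b) and q =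
        \<xi>\<zeta>\<iota>\<iota>\<open>D\<close>(c).\<close>
      using right_commute[of "\<zeta> (\<zeta> a)" "\<xi> (\<zeta> (\<iota> (\<iota> (D b))))" "\<xi> (\<zeta> (\<iota> (\<iota> (D c))))"]
      by (simp add: maps_mult maps_commute)
  qed
  ultimately show ?thesis ..
qed

end
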